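(* Let $a\in\mathbb R$, $a\neq0$, and $$W(x)=e^{-x^2}\begin{pmatrix}1+a^2x^4&ax^2\\ ax^2&1\end{pmatrix},\qquad x\in\mathbb R.$$ Let $H_n$, $n\ge0$, be the sequence of monic orthogonal polynomials for the classical scalar Hermite weight $e^{-x^2}$ on $\mathbb R$. Then $$Q_n(x)=\begin{pmatrix}\frac4aH_n(x)&-2H_n(x)-4xnH_{n-1}(x)+n(n-1)H_{n-2}(x)\\ -n(n-1)H_{n-2}(x)&\frac4aH_n(x)+ax^2n(n-1)H_{n-2}(x)\end{pmatrix},\qquad n\ge0,$$ is a sequence of orthogonal polynomials with respect to $W$.
   Context: A sequence of (matrix-valued) orthogonal polynomials for a weight matrix $W$ of size $N$ on $(x_0,x_1)$ is a sequence $Q_n\in\operatorname{Mat}_N(\mathbb C[x])$, $n\ge0$, such that $Q_n$ has degree $n$ with nonsingular leading coefficient and $\int_{x_0}^{x_1}Q_n(x)W(x)Q_m(x)^*\,dx=0$ for $n\neq m$. Convention: $H_{-1}=H_{-2}=0$ (these only appear with coefficient zero). *)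

theory Defs
  imports "HOL-Analysis.Analysis" "HOL-Computational_Algebra.Polynomial"
begin

text \<open>
  The endpoints of an interval are extended reals, so that \<^term>\<open>einterval x0 x1\<close> also covers
  unbounded intervals such as the real line.  All integrals are Lebesgue integrals.  A Bochner
  integral of a non-integrable function is 0 by convention; requiring finite moments in the notion
  of weight ensures that every integral used to express orthogonality exists.
\<close>

subsection \<open>Scalar monic orthogonal polynomials\<close>

definition scalar_weight :: "ereal \<Rightarrow> ereal \<Rightarrow> (real \<Rightarrow> real) \<Rightarrow> bool" where
  "scalar_weight x0 x1 w \<longleftrightarrow>
     (\<forall>k::nat. set_integrable lborel (einterval x0 x1) (\<lambda>x. x ^ k * w x)) \<and>
     (AE x in lborel. x \<in> einterval x0 x1 \<longrightarrow> 0 < w x)"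

definition monic_orthogonal_polynomials ::
    "ereal \<Rightarrow> ereal \<Rightarrow> (real \<Rightarrow> real) \<Rightarrow> (nat \<Rightarrow> complex poly) \<Rightarrow> bool" where
  "monic_orthogonal_polynomials x0 x1 w p \<longleftrightarrow>
     scalar_weight x0 x1 w \<and>
     (\<forall>n. degree (p n) = n \<and> lead_coeff (p n) = 1) \<and>
     (\<forall>n m. n \<noteq> m \<longrightarrow>
        (LINT x:einterval x0 x1|lborel.
           poly (p n) (of_real x) * of_real (w x) * cnj (poly (p m) (of_real x))) = 0)"

text \<open>Extension of a sequence to integer indices, with value 0 at negative indices.\<close>

definition zero_ext :: "(nat \<Rightarrow> 'a::zero) \<Rightarrow> int \<Rightarrow> 'a" where
  "zero_ext p k = (if k < 0 then 0 else p (nat k))"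

subsection \<open>Matrix-valued orthogonal polynomials\<close>

definition conj_transpose :: "complex ^ 'n ^ 'm \<Rightarrow> complex ^ 'm ^ 'n" where
  "conj_transpose A = (\<chi> i j. cnj (A $ j $ i))"

text \<open>For a Hermitian matrix the quadratic form is real, so taking \<^const>\<open>Re\<close> loses nothing.\<close>

definition positive_definite :: "complex ^ 'n ^ 'n \<Rightarrow> bool" where
  "positive_definite A \<longleftrightarrow>
     conj_transpose A = A \<and>
     (\<forall>v. v \<noteq> 0 \<longrightarrow> 0 < Re (\<Sum>i\<in>UNIV. cnj (v $ i) * (A *v v) $ i))"

definition weight_matrix :: "ereal \<Rightarrow> ereal \<Rightarrow> (real \<Rightarrow> complex ^ 'n ^ 'n) \<Rightarrow> bool" where
  "weight_matrix x0 x1 W \<longleftrightarrow>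
     (\<forall>(k::nat) i j. set_integrable lborel (einterval x0 x1) (\<lambda>x. of_real (x ^ k) * W x $ i $ j)) \<and>
     (AE x in lborel. x \<in> einterval x0 x1 \<longrightarrow> positive_definite (W x))"

definition mat_poly :: "complex poly ^ 'n ^ 'm \<Rightarrow> real \<Rightarrow> complex ^ 'n ^ 'm" where
  "mat_poly P x = (\<chi> i j. poly (P $ i $ j) (of_real x))"

definition mat_coeff :: "complex poly ^ 'n ^ 'm \<Rightarrow> nat \<Rightarrow> complex ^ 'n ^ 'm" where
  "mat_coeff P k = (\<chi> i j. coeff (P $ i $ j) k)"

definition mat_degree :: "complex poly ^ 'n ^ 'm \<Rightarrow> nat" where
  "mat_degree P = Max {degree (P $ i $ j) | i j. True}"

definition mat_inner ::
    "ereal \<Rightarrow> ereal \<Rightarrow> (real \<Rightarrow> complex ^ 'n ^ 'n) \<Rightarrow>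
     complex poly ^ 'n ^ 'n \<Rightarrow> complex poly ^ 'n ^ 'n \<Rightarrow> complex ^ 'n ^ 'n" where
  "mat_inner x0 x1 W P Q =
     (\<chi> i j. LINT x:einterval x0 x1|lborel.
        (mat_poly P x ** W x ** conj_transpose (mat_poly Q x)) $ i $ j)"

definition matrix_orthogonal_polynomials ::
    "ereal \<Rightarrow> ereal \<Rightarrow> (real \<Rightarrow> complex ^ 'n ^ 'n) \<Rightarrow> (nat \<Rightarrow> complex poly ^ 'n ^ 'n) \<Rightarrow> bool" where
  "matrix_orthogonal_polynomials x0 x1 W Q \<longleftrightarrow>
     weight_matrix x0 x1 W \<and>
     (\<forall>n. mat_degree (Q n) = n \<and> invertible (mat_coeff (Q n) n)) \<and>
     (\<forall>n m. n \<noteq> m \<longrightarrow> mat_inner x0 x1 W (Q n) (Q m) = 0)"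

end

theory Submission
  imports Defs "HOL-Probability.Distributions" "HOL-Real_Asymp.Real_Asymp"
begin

text \<open>
  For the weight \<open>exp (- x\<^sup>2)\<close>, integration by parts turns the raising step
  \<open>p \<mapsto> x p - p' / 2\<close> into the adjoint of half the derivative, so iterating it from 1 gives the monic
  Hermite polynomials.
  The weight matrix factors as \<open>exp (- x\<^sup>2) T(x) T(x)\<^sup>*\<close> with
  \<open>T(x) = ((1, a x\<^sup>2), (0, 1))\<close>.  Applying the raising step twice gives
  \<open>4 H\<^sub>n\<^sub>+\<^sub>2 = 4 x\<^sup>2 H\<^sub>n - 2 H\<^sub>n - 4 x H\<^sub>n' + H\<^sub>n''\<close>, and hence
  \<open>Q\<^sub>n T = ((4 H\<^sub>n / a, 4 H\<^sub>n\<^sub>+\<^sub>2), (- H\<^sub>n'', 4 H\<^sub>n / a))\<close>.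
  The diagonal entries of the inner product of \<open>Q\<^sub>n\<close> and \<open>Q\<^sub>m\<close> vanish by scalar orthogonality,
  as \<open>H\<^sub>n'' = n (n - 1) H\<^sub>n\<^sub>-\<^sub>2\<close>; in the off-diagonal entries the two summands cancel by adjointness.
\<close>

subsection \<open>Gaussian integrals of polynomials\<close>

definition gauss_fun :: "complex poly \<Rightarrow> real \<Rightarrow> complex" where
  "gauss_fun p x = poly p (of_real x) * of_real (exp (- x\<^sup>2))"

definition gauss_int :: "complex poly \<Rightarrow> complex" where
  "gauss_int p = (LINT x|lborel. gauss_fun p x)"

text \<open>Up to the factor \<open>sqrt pi\<close> this is the normal density of variance 1/2,
  whose known moments and total mass yield integrability and the normalisation.\<close>

lemma exp_minus_square_eq_normal_density:
  "exp (- x\<^sup>2) = sqrt pi * normal_density 0 (1 / sqrt 2) x"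
proof -
  have "sqrt (2 * pi * (1 / sqrt 2)\<^sup>2) = sqrt pi" and "2 * (1 / sqrt 2)\<^sup>2 = (1::real)"
    by (simp_all add: power_divide)
  then show ?thesis
    by (simp only: normal_density_def) simp
qed

lemma integrable_power_gauss: "integrable lborel (\<lambda>x::real. x ^ k * exp (- x\<^sup>2))"
proof -
  have "integrable lborel (\<lambda>x. sqrt pi * (normal_density 0 (1 / sqrt 2) x * (x - 0) ^ k))"
    by (intro integrable_mult_right integrable_normal_moment) simp
  then show ?thesis
    by (simp add: exp_minus_square_eq_normal_density mult_ac)
qed

lemma gauss_fun_altdef:
  "gauss_fun p x = (\<Sum>i\<le>degree p. coeff p i * of_real (x ^ i * exp (- x\<^sup>2)))"
  by (simp add: gauss_fun_def poly_altdef sum_distrib_left mult_ac)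

lemma integrable_gauss_fun [simp]: "integrable lborel (gauss_fun p)"
  unfolding gauss_fun_altdef[abs_def]
  by (intro Bochner_Integration.integrable_sum integrable_mult_right integrable_of_real
      integrable_power_gauss)

lemma gauss_fun_linear [simp]:
  "gauss_fun (p + q) x = gauss_fun p x + gauss_fun q x"
  "gauss_fun (p - q) x = gauss_fun p x - gauss_fun q x"
  "gauss_fun (- p) x = - gauss_fun p x"
  "gauss_fun (smult c p) x = c * gauss_fun p x"
  by (simp_all add: gauss_fun_def algebra_simps)

lemma gauss_int_linear [simp]:
  "gauss_int (p + q) = gauss_int p + gauss_int q"
  "gauss_int (p - q) = gauss_int p - gauss_int q"
  "gauss_int (- p) = - gauss_int p"
  "gauss_int (smult c p) = c * gauss_int p"
  by (simp_all add: gauss_int_def)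

lemma gauss_int_0 [simp]: "gauss_int 0 = 0"
  by (simp add: gauss_int_def gauss_fun_def)

lemma gauss_int_1: "gauss_int 1 = of_real (sqrt pi)"
proof -
  have "gauss_int 1 = (LINT x|lborel. of_real (sqrt pi * normal_density 0 (1 / sqrt 2) x))"
    by (simp add: gauss_int_def gauss_fun_def exp_minus_square_eq_normal_density)
  also have "\<dots> = of_real (sqrt pi)"
    by (subst integral_complex_of_real) simp
  finally show ?thesis .
qed

section \<open>Decay at infinity and integration by parts\<close>

lemma tendsto_gauss_fun:
  assumes "\<And>k. ((\<lambda>x. x ^ k * exp (- x\<^sup>2)) \<longlongrightarrow> 0) F"
  shows "(gauss_fun p \<longlongrightarrow> 0) F"
  unfolding gauss_fun_altdef[abs_def]
proof (rule tendsto_null_sum)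
  fix i
  have "((\<lambda>x. complex_of_real (x ^ i * exp (- x\<^sup>2))) \<longlongrightarrow> of_real 0) F"
    by (rule tendsto_of_real[OF assms])
  then show "((\<lambda>x. coeff p i * complex_of_real (x ^ i * exp (- x\<^sup>2))) \<longlongrightarrow> 0) F"
    by (simp add: tendsto_mult_right_zero)
qed

lemma power_gauss_tendsto_at_top: "((\<lambda>x::real. x ^ k * exp (- x\<^sup>2)) \<longlongrightarrow> 0) at_top"
  by real_asymp

lemma power_gauss_tendsto_at_bot: "((\<lambda>x::real. x ^ k * exp (- x\<^sup>2)) \<longlongrightarrow> 0) at_bot"
proof -
  have "((\<lambda>x::real. (-1) ^ k * (x ^ k * exp (- x\<^sup>2))) \<longlongrightarrow> 0) at_top"
    by (intro tendsto_mult_right_zero power_gauss_tendsto_at_top)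
  moreover have "(\<lambda>x::real. (-1) ^ k * (x ^ k * exp (- x\<^sup>2))) = (\<lambda>x. (- x) ^ k * exp (- (- x)\<^sup>2))"
    by (simp flip: power_mult_distrib mult.assoc)
  ultimately show ?thesis
    by (simp add: filterlim_at_bot_mirror)
qed

lemma gauss_fun_has_vector_derivative:
  "(gauss_fun p has_vector_derivative gauss_fun (pderiv p - [:0, 2:] * p) x) (at x)"
proof -
  have exp_eq: "exp (- (of_real t)\<^sup>2) = complex_of_real (exp (- t\<^sup>2))" for t
    by (metis exp_of_real of_real_minus of_real_power)
  \<comment> \<open>Differentiate the entire function \<open>p(z) exp(-z^2)\<close> on the complex
    plane, then restrict to the real line.\<close>
  have "((\<lambda>z. poly p z * exp (- z\<^sup>2)) has_field_derivative
      gauss_fun (pderiv p - [:0, 2:] * p) x) (at (of_real x))"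
    by (rule derivative_eq_intros poly_DERIV refl)+
      (simp add: gauss_fun_def exp_eq algebra_simps)
  from has_vector_derivative_real_field[OF this] show ?thesis
    by (simp only: gauss_fun_def[abs_def] exp_eq)
qed

text \<open>The derivative of \<open>p(x) exp(-x^2)\<close> integrates to 0 over the real line,
  because its boundary values vanish at both ends.\<close>

lemma gauss_int_pderiv: "gauss_int (pderiv p) = gauss_int ([:0, 2:] * p)"
proof -
  let ?f = "gauss_fun (pderiv p - [:0, 2:] * p)"
  have "(LBINT x=-\<infinity>..\<infinity>. ?f x) = 0 - 0"
  proof (rule interval_integral_FTC_integrable)
    show "(gauss_fun p has_vector_derivative ?f x) (at x)" for x
      by (rule gauss_fun_has_vector_derivative)
    show "isCont ?f x" for x
      by (rule has_vector_derivative_continuous[OF gauss_fun_has_vector_derivative])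
    show "set_integrable lborel (einterval (- \<infinity>) \<infinity>) ?f"
      unfolding set_integrable_def by simp
    show "((gauss_fun p \<circ> real_of_ereal) \<longlongrightarrow> 0) (at_right (- \<infinity>))"
      unfolding ereal_tendsto_simps
      by (intro tendsto_gauss_fun power_gauss_tendsto_at_bot)
    show "((gauss_fun p \<circ> real_of_ereal) \<longlongrightarrow> 0) (at_left \<infinity>)"
      unfolding ereal_tendsto_simps
      by (intro tendsto_gauss_fun power_gauss_tendsto_at_top)
  qed simp
  then have "gauss_int (pderiv p - [:0, 2:] * p) = 0"
    by (simp add: interval_lebesgue_integral_def set_lebesgue_integral_def gauss_int_def
        del: gauss_fun_linear)
  then show ?thesis
    by (simp only: gauss_int_linear) simp
qed

subsection \<open>Monic Hermite polynomials\<close>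

fun hermite :: "nat \<Rightarrow> complex poly" where
  "hermite 0 = 1"
| "hermite (Suc n) = [:0, 1:] * hermite n - smult (1 / 2) (pderiv (hermite n))"

declare hermite.simps(2) [simp del]

lemmas hermite_Suc = hermite.simps(2)

lemma degree_lead_coeff_hermite: "degree (hermite n) = n \<and> coeff (hermite n) n = 1"
proof (induction n)
  case (Suc n)
  have "degree (hermite (Suc n)) \<le> Suc n"
    using Suc unfolding hermite_Suc
    by (auto intro!: degree_diff_le order_trans[OF degree_pCons_le] simp: degree_pderiv)
  moreover have "coeff (hermite (Suc n)) (Suc n) = 1"
    using Suc by (simp add: hermite_Suc coeff_pderiv coeff_eq_0)
  ultimately show ?case
    by (metis le_antisym le_degree zero_neq_one)
qed simp

lemma degree_hermite [simp]: "degree (hermite n) = n"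
  and coeff_hermite_self [simp]: "coeff (hermite n) n = 1"
  using degree_lead_coeff_hermite by auto

text \<open>Makes the conjugations in the inner products disappear on the real line.\<close>

lemma coeff_hermite_real: "coeff (hermite n) k \<in> \<real>"
  by (induction n arbitrary: k) (auto simp: hermite_Suc coeff_pCons coeff_pderiv split: nat.splits)

lemma cnj_poly_hermite [simp]: "cnj (poly (hermite n) (of_real x)) = poly (hermite n) (of_real x)"
  by (simp add: poly_cnj_real coeff_hermite_real)

lemma pderiv_hermite: "pderiv (hermite n) = smult (of_nat n) (hermite (n - 1))"
proof (induction n)
  case (Suc n)
  show ?case
  proof (cases n)
    case (Suc m)
    have "pderiv (hermite (Suc n)) =
        hermite n + [:0, 1:] * pderiv (hermite n) - smult (1 / 2) (pderiv (pderiv (hermite n)))"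
      by (simp add: hermite_Suc pderiv_diff pderiv_smult pderiv_pCons)
    \<comment> \<open>By the induction hypothesis, \<open>x H_n' - H_n''/2\<close> is
      \<open>n\<close> times the raising step applied to \<open>H_m\<close>, where
      \<open>n = Suc m\<close>.\<close>
    also have "\<dots> = hermite n + smult (of_nat n) (hermite (Suc m))"
      using Suc Suc.IH by (simp add: pderiv_smult smult_diff_right mult_ac hermite_Suc[of m])
    finally show ?thesis
      using Suc by (simp add: smult_add_left numeral_mult_conv_smult)
  qed (simp add: hermite_Suc pderiv_pCons pderiv_diff)
qed simp

text \<open>The right-hand side is \<open>4 x^2 H_n\<close> plus the upper right entry of
  \<open>Q_n\<close>, written with derivatives in place of lower indices.\<close>

lemma four_hermite_Suc_Suc:
  "smult 4 (hermite (n + 2)) =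
     [:0, 1:]\<^sup>2 * smult 4 (hermite n) - smult 2 (hermite n) - smult 4 ([:0, 1:] * pderiv (hermite n))
     + pderiv (pderiv (hermite n))"
  unfolding poly_eq_poly_eq_iff[symmetric]
  by (simp add: fun_eq_iff hermite_Suc power2_eq_square pderiv_pCons pderiv_diff pderiv_smult
      algebra_simps)

section \<open>Adjointness of raising and differentiation, and scalar orthogonality\<close>

lemma gauss_int_hermite_Suc: "gauss_int (hermite (Suc n) * q) = gauss_int (hermite n * pderiv q) / 2"
proof -
  have "smult 2 (hermite (Suc n) * q) = [:0, 2:] * (hermite n * q) - pderiv (hermite n) * q"
    unfolding poly_eq_poly_eq_iff[symmetric] by (simp add: fun_eq_iff hermite_Suc algebra_simps)
  then have "2 * gauss_int (hermite (Suc n) * q) =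
      gauss_int ([:0, 2:] * (hermite n * q)) - gauss_int (pderiv (hermite n) * q)"
    by (metis gauss_int_linear(2,4))
  \<comment> \<open>Integration by parts turns the first integrand into \<open>(H_n q)'\<close>; the
    product rule then cancels \<open>H_n' q\<close>.\<close>
  also have "\<dots> = gauss_int (hermite n * pderiv q)"
    unfolding gauss_int_pderiv[symmetric] by (simp add: pderiv_mult mult_ac)
  finally show ?thesis by (simp add: field_simps)
qed

lemma gauss_int_hermite: "gauss_int (hermite n * q) = gauss_int ((pderiv ^^ n) q) / 2 ^ n"
  by (induction n arbitrary: q)
    (simp_all add: gauss_int_hermite_Suc funpow_Suc_right del: funpow.simps(2))

lemma higher_pderiv_degree: "(pderiv ^^ degree q) q = [:fact (degree q) * lead_coeff q:]"
  for q :: "complex poly"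
proof -
  have "degree ((pderiv ^^ degree q) q) = 0"
    by (simp add: degree_higher_pderiv)
  then obtain c where c: "(pderiv ^^ degree q) q = [:c:]"
    by (rule degree_eq_zeroE)
  have "c = coeff ((pderiv ^^ degree q) q) 0"
    by (simp add: c)
  also have "\<dots> = fact (degree q) * lead_coeff q"
    by (simp add: coeff_higher_pderiv pochhammer_fact)
  finally show ?thesis
    using c by simp
qed

text \<open>Moving all raising steps onto \<open>q\<close> leaves a nonzero constant, whose Gaussian
  integral is a nonzero multiple of \<open>sqrt pi\<close>. This is what forces uniqueness
  below.\<close>

lemma gauss_int_hermite_degree_nonzero:
  assumes "q \<noteq> 0"
  shows "gauss_int (hermite (degree q) * q) \<noteq> 0"
proof -
  have "[:fact (degree q) * lead_coeff q:] = smult (fact (degree q) * lead_coeff q) 1"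
    by simp
  then show ?thesis
    using assms
    by (simp only: gauss_int_hermite higher_pderiv_degree gauss_int_linear gauss_int_1) simp
qed

lemma gauss_int_hermite_orthogonal:
  assumes "n \<noteq> m"
  shows "gauss_int (hermite n * hermite m) = 0"
proof -
  have less: "gauss_int (hermite i * hermite j) = 0" if "j < i" for i j
  proof -
    \<comment> \<open>More derivatives than the degree.\<close>
    have "(pderiv ^^ i) (hermite j) = 0"
      using that by (intro poly_eqI) (simp add: coeff_higher_pderiv coeff_eq_0)
    then show ?thesis
      by (simp add: gauss_int_hermite)
  qed
  show ?thesis
    using assms less[of n m] less[of m n] by (metis mult.commute nat_neq_iff)
qed

section \<open>Uniqueness of the monic orthogonal sequence\<close>

lemma monic_orthogonal_polynomials_gauss_unique:
  assumes H: "monic_orthogonal_polynomials (-\<infinity>) \<infinity> (\<lambda>x. exp (- x\<^sup>2)) H"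
  shows "H = hermite"
proof
  have H_monic: "\<forall>n. degree (H n) = n \<and> lead_coeff (H n) = 1"
    using H unfolding monic_orthogonal_polynomials_def by (elim conjE)
  have H_orthogonal: "(LINT x:einterval (-\<infinity>) \<infinity>|lborel.
      poly (H n) (of_real x) * of_real (exp (- x\<^sup>2)) * cnj (poly (H m) (of_real x))) = 0"
    if "n \<noteq> m" for n m
    using H that unfolding monic_orthogonal_polynomials_def by (elim conjE) metis
  fix n
  show "H n = hermite n"
  proof (induction n rule: less_induct)
    case (less n)
    have deg: "degree (H n) = n" "coeff (H n) n = 1"
      using H_monic[rule_format, of n] by auto
    \<comment> \<open>By induction \<open>hermite m\<close> is \<open>H m\<close>, so the assumed
      orthogonality of \<open>H\<close> applies.\<close>
    have orth: "gauss_int (H n * hermite m) = 0" if "m < n" for m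
    proof -
      have "gauss_int (H n * hermite m) = (LINT x:einterval (-\<infinity>) \<infinity>|lborel.
          poly (H n) (of_real x) * of_real (exp (- x\<^sup>2)) * cnj (poly (H m) (of_real x)))"
        by (simp add: less.IH[OF that] gauss_int_def gauss_fun_def set_lebesgue_integral_def mult_ac)
      also have "\<dots> = 0"
        using that by (intro H_orthogonal) simp
      finally show ?thesis .
    qed
    \<comment> \<open>The leading terms cancel, so \<open>d\<close> has degree below
      \<open>n\<close> if nonzero. It is then orthogonal to \<open>hermite (degree d)\<close>, which
      only the zero polynomial can be.\<close>
    define d where "d = H n - hermite n"
    have "d = 0"
    proof (rule ccontr)
      assume "d \<noteq> 0"
      have "degree d < n"
      proof (rule ccontr)
        assume "\<not> degree d < n"
        moreover have "degree d \<le> n"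
          unfolding d_def by (intro degree_diff_le) (simp_all add: deg)
        ultimately have "degree d = n" by simp
        then have "lead_coeff d = 0"
          by (simp add: d_def deg)
        with \<open>d \<noteq> 0\<close> show False by simp
      qed
      moreover have "hermite k * d = H n * hermite k - hermite n * hermite k" for k
        by (simp add: d_def left_diff_distrib mult.commute[of "hermite k"])
      ultimately have "gauss_int (hermite (degree d) * d) = 0"
        by (simp add: orth gauss_int_hermite_orthogonal)
      with gauss_int_hermite_degree_nonzero[OF \<open>d \<noteq> 0\<close>] show False by simp
    qed
    then show ?case by (simp add: d_def)
  qed
qed

subsection \<open>The matrix weight\<close>

text \<open>The Euler operator acts diagonally on coefficients, so those of \<open>Q_n\<close> can
  be read off without index shifts.\<close>

lemma coeff_X_mult_pderiv: "coeff ([:0, 1:] * pderiv p) k = of_nat k * coeff p k"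
  by (cases k) (simp_all add: coeff_pderiv)

lemma coeff_X_square_mult_pderiv_pderiv:
  "coeff ([:0, 1:]\<^sup>2 * pderiv (pderiv p)) k = of_nat k * (of_nat k - 1) * coeff p k"
  for p :: "'a :: idom poly"
  by (cases k; cases "k - 1") (simp_all add: power2_eq_square coeff_pderiv algebra_simps)

lemma gauss_weight_matrix:
  fixes a :: real and W :: "real \<Rightarrow> complex ^ 2 ^ 2"
  assumes W: "\<And>x. W x = vector
        [vector [of_real (exp (- x\<^sup>2) * (1 + a\<^sup>2 * x ^ 4)), of_real (exp (- x\<^sup>2) * (a * x\<^sup>2))],
         vector [of_real (exp (- x\<^sup>2) * (a * x\<^sup>2)), of_real (exp (- x\<^sup>2))]]"
  shows "weight_matrix (-\<infinity>) \<infinity> W"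
  unfolding weight_matrix_def
proof (intro conjI allI AE_I2 impI)
  fix k :: nat and i j :: 2
  have entries: "(\<lambda>x. of_real (x ^ k) * W x $ 1 $ 1) =
        gauss_fun (monom 1 k + smult (of_real (a\<^sup>2)) (monom 1 (k + 4)))"
      "(\<lambda>x. of_real (x ^ k) * W x $ 1 $ 2) = gauss_fun (smult (of_real a) (monom 1 (k + 2)))"
      "(\<lambda>x. of_real (x ^ k) * W x $ 2 $ 1) = gauss_fun (smult (of_real a) (monom 1 (k + 2)))"
      "(\<lambda>x. of_real (x ^ k) * W x $ 2 $ 2) = gauss_fun (monom 1 k)"
    by (auto simp: fun_eq_iff W gauss_fun_def poly_monom power_add power2_eq_square algebra_simps)
  have "integrable lborel (\<lambda>x. of_real (x ^ k) * W x $ i $ j)"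
    using exhaust_2[of i] exhaust_2[of j]
    by (elim disjE; hypsubst) (simp_all only: entries integrable_gauss_fun)
  then show "set_integrable lborel (einterval (-\<infinity>) \<infinity>) (\<lambda>x. of_real (x ^ k) * W x $ i $ j)"
    by (simp add: set_integrable_def)
next
  fix x
  show "positive_definite (W x)"
    unfolding positive_definite_def
  proof (intro conjI allI impI)
    show "conj_transpose (W x) = W x"
      by (simp add: conj_transpose_def vec_eq_iff forall_2 W)
    fix v :: "complex ^ 2"
    assume "v \<noteq> 0"
    \<comment> \<open>This is the squared norm of \<open>T(x)^* v\<close>, positive because
      \<open>T(x)\<close> is unitriangular.\<close>
    let ?s = "(cmod (v $ 1))\<^sup>2 + (cmod (of_real (a * x\<^sup>2) * v $ 1 + v $ 2))\<^sup>2"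
    have "Re (\<Sum>i\<in>UNIV. cnj (v $ i) * (W x *v v) $ i) = exp (- x\<^sup>2) * ?s"
      unfolding cmod_power2
      by (simp add: sum_2 matrix_vector_mult_def W) (simp add: algebra_simps power2_eq_square power4_eq_xxxx)
    moreover have "?s > 0"
    proof (cases "v $ 1 = 0")
      case True
      with \<open>v \<noteq> 0\<close> have "v $ 2 \<noteq> 0"
        by (auto simp: vec_eq_iff forall_2)
      with True show ?thesis by simp
    qed (simp add: add_pos_nonneg)
    ultimately show "0 < Re (\<Sum>i\<in>UNIV. cnj (v $ i) * (W x *v v) $ i)"
      by simp
  qed
qed

section \<open>Degree, leading coefficient and orthogonality of the matrix polynomials\<close>

theorem corollary5p5:
  fixes a :: real
    and W :: "real \<Rightarrow> complex ^ 2 ^ 2"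
    and H :: "nat \<Rightarrow> complex poly"
    and Q :: "nat \<Rightarrow> complex poly ^ 2 ^ 2"
  assumes a: "a \<noteq> 0"
    and W: "\<And>x. W x = vector
        [vector [of_real (exp (- x\<^sup>2) * (1 + a\<^sup>2 * x ^ 4)), of_real (exp (- x\<^sup>2) * (a * x\<^sup>2))],
         vector [of_real (exp (- x\<^sup>2) * (a * x\<^sup>2)), of_real (exp (- x\<^sup>2))]]"
    and H: "monic_orthogonal_polynomials (-\<infinity>) \<infinity> (\<lambda>x. exp (- x\<^sup>2)) H"
    and Q: "\<And>n. Q n = vector
        [vector
          [smult (of_real (4 / a)) (H n),
           - 2 * H n - 4 * [:0, 1:] * of_nat n * zero_ext H (int n - 1)
             + of_nat n * (of_nat n - 1) * zero_ext H (int n - 2)],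
         vector
          [- (of_nat n * (of_nat n - 1) * zero_ext H (int n - 2)),
           smult (of_real (4 / a)) (H n)
             + smult (of_real a) ([:0, 1:]\<^sup>2 * of_nat n * (of_nat n - 1) * zero_ext H (int n - 2))]]"
  shows "matrix_orthogonal_polynomials (-\<infinity>) \<infinity> W Q"
proof -
  have H_eq: "H = hermite"
    by (rule monic_orthogonal_polynomials_gauss_unique[OF H])
  have of_nat_smult: "of_nat k * p = smult (of_nat k) p" for k and p :: "complex poly"
    by (simp add: of_nat_poly)
  have d1: "of_nat n * zero_ext H (int n - 1) = pderiv (H n)" for n
  proof (cases n)
    case (Suc k)
    have "zero_ext H (int n - 1) = H k"
      by (simp add: zero_ext_def Suc)
    then show ?thesis
      by (simp only: of_nat_smult H_eq pderiv_hermite Suc diff_Suc_1)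
  qed (simp add: H_eq)
  \<comment> \<open>For \<open>n < 2\<close> the coefficient vanishes, matching the second
    derivative of a polynomial of degree at most 1.\<close>
  have d2: "of_nat n * (of_nat n - 1) * zero_ext H (int n - 2) = pderiv (pderiv (H n))" for n
  proof (cases "n < 2")
    case True
    then have "n = 0 \<or> n = 1" by auto
    then show ?thesis
      by (auto simp: zero_ext_def H_eq pderiv_hermite pderiv_smult)
  next
    case False
    then obtain m where n: "n = m + 2"
      by (metis add.commute le_Suc_ex not_less)
    have "of_nat n * (of_nat n - 1) * zero_ext H (int n - 2)
        = of_nat n * (of_nat (m + 1) * hermite m)"
      by (simp add: n zero_ext_def H_eq)
    also have "\<dots> = pderiv (pderiv (H n))"
      by (simp only: of_nat_smult H_eq pderiv_hermite pderiv_smult n) simp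
    finally show ?thesis .
  qed
  have Q_eq: "Q n = vector
        [vector
          [smult (of_real (4 / a)) (hermite n),
           - smult 2 (hermite n) - smult 4 ([:0, 1:] * pderiv (hermite n)) + pderiv (pderiv (hermite n))],
         vector
          [- pderiv (pderiv (hermite n)),
           smult (of_real (4 / a)) (hermite n)
             + smult (of_real a) ([:0, 1:]\<^sup>2 * pderiv (pderiv (hermite n)))]]" for n
  proof -
    have d2': "of_nat n * ((of_nat n - 1) * zero_ext H (int n - 2)) = pderiv (pderiv (H n))"
      using d2[of n] by (simp only: mult.assoc)
    show ?thesis
      unfolding Q mult.assoc d1 d2' minus_mult_left[symmetric]
      by (simp only: numeral_mult_conv_smult H_eq)
  qed
  \<comment> \<open>Taking \<open>k > n\<close> gives the degree bound, and \<open>k = n\<close> the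
    leading coefficient, which is upper triangular.\<close>
  have coeffs: "mat_coeff (Q n) k = vector
      [vector [of_real (4 / a) * coeff (hermite n) k,
         - (2 + 4 * of_nat k) * coeff (hermite n) k + coeff (pderiv (pderiv (hermite n))) k],
       vector [- coeff (pderiv (pderiv (hermite n))) k,
         of_real (4 / a + a * (real k * (real k - 1))) * coeff (hermite n) k]]" for n k
    by (simp add: mat_coeff_def Q_eq vec_eq_iff forall_2 coeff_X_mult_pderiv
        coeff_X_square_mult_pderiv_pderiv del: mult_pCons_left)
      (simp add: algebra_simps)
  have pderiv2_coeff: "coeff (pderiv (pderiv (hermite n))) k = 0" if "n \<le> k" for n k
    using that by (simp add: coeff_pderiv coeff_eq_0)
  have "mat_degree (Q n) = n" for n
    unfolding mat_degree_def
  proof (rule Max_eqI)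
    have "{degree (Q n $ i $ j) |i j. True} = range (\<lambda>(i, j). degree (Q n $ i $ j))"
      by auto
    then show "finite {degree (Q n $ i $ j) |i j. True}"
      by simp
    have "n = degree (Q n $ 1 $ 1)"
      using a by (simp add: Q_eq)
    then show "n \<in> {degree (Q n $ i $ j) |i j. True}"
      by force
    have "coeff (Q n $ i $ j) k = 0" if "n < k" for i j k
    proof -
      have "mat_coeff (Q n) k = 0"
        using that by (simp add: coeffs pderiv2_coeff coeff_eq_0 vec_eq_iff forall_2)
      then show ?thesis
        by (simp add: mat_coeff_def vec_eq_iff)
    qed
    then have "degree (Q n $ i $ j) \<le> n" for i j
      by (intro degree_le) blast
    then show "d \<le> n" if "d \<in> {degree (Q n $ i $ j) |i j. True}" for d
      using that by blast
  qed
  moreover have "invertible (mat_coeff (Q n) n)" for n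
  proof -
    \<comment> \<open>The determinant is the product of the diagonal entries \<open>4/a\<close> and
      \<open>4/a + a n (n - 1)\<close>.\<close>
    have "0 \<le> real n * (real n - 1)"
      by (cases n) simp_all
    then have "16 / a\<^sup>2 + 4 * (real n * (real n - 1)) > 0"
      using a by (intro add_pos_nonneg) simp_all
    moreover have "det (mat_coeff (Q n) n) = of_real (16 / a\<^sup>2 + 4 * (real n * (real n - 1)))"
      using a by (simp add: coeffs det_2 pderiv2_coeff power2_eq_square field_simps)
    ultimately show ?thesis
      by (metis invertible_det_nz less_irrefl of_real_eq_0_iff)
  qed
  moreover have "mat_inner (-\<infinity>) \<infinity> W (Q n) (Q m) = 0" if "n \<noteq> m" for n m
  proof -
    let ?h = hermite
    let ?h'' = "\<lambda>n. pderiv (pderiv (hermite n))"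
    \<comment> \<open>Up to the Gaussian factor, this is the Hermitian product of row
      \<open>i\<close> of \<open>M T(x)\<close> with row \<open>j\<close> of
      \<open>K T(x)\<close>.\<close>
    have factor: "(M ** W x ** conj_transpose K) $ i $ j = of_real (exp (- x\<^sup>2)) *
        (M $ i $ 1 * cnj (K $ j $ 1) + (of_real (a * x\<^sup>2) * M $ i $ 1 + M $ i $ 2) *
           cnj (of_real (a * x\<^sup>2) * K $ j $ 1 + K $ j $ 2))" for M K x i j
      by (simp add: matrix_matrix_mult_def sum_2 conj_transpose_def W power2_eq_square
          power4_eq_xxxx algebra_simps)
    have fst_col: "mat_poly (Q n) x $ 1 $ 1 = of_real (4 / a) * poly (?h n) (of_real x)"
      "mat_poly (Q n) x $ 2 $ 1 = - poly (?h'' n) (of_real x)" for n x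
      by (simp_all add: mat_poly_def Q_eq)
    have snd_col1: "of_real (a * x\<^sup>2) * mat_poly (Q n) x $ 1 $ 1 + mat_poly (Q n) x $ 1 $ 2 =
        4 * poly (?h (n + 2)) (of_real x)" for n x
    proof -
      have "4 * poly (?h (n + 2)) (of_real x) = poly (smult 4 (?h (n + 2))) (of_real x)"
        by simp
      then show ?thesis
        using a unfolding four_hermite_Suc_Suc by (simp add: mat_poly_def Q_eq algebra_simps)
    qed
    \<comment> \<open>The two terms \<open>a x^2 H_n''\<close> cancel.\<close>
    have snd_col2: "of_real (a * x\<^sup>2) * mat_poly (Q n) x $ 2 $ 1 + mat_poly (Q n) x $ 2 $ 2 =
        of_real (4 / a) * poly (?h n) (of_real x)" for n x
      by (simp add: mat_poly_def Q_eq algebra_simps)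
    have cnj'': "cnj (poly (?h'' n) (of_real x)) = poly (?h'' n) (of_real x)" for n x
      by (simp add: pderiv_hermite pderiv_smult)
    have integrands:
      "(mat_poly (Q n) x ** W x ** conj_transpose (mat_poly (Q m) x)) $ 1 $ 1 = gauss_fun
        (smult (of_real (16 / a\<^sup>2)) (?h n * ?h m) + smult 16 (?h (n + 2) * ?h (m + 2))) x"
      "(mat_poly (Q n) x ** W x ** conj_transpose (mat_poly (Q m) x)) $ 1 $ 2 = gauss_fun
        (smult (of_real (16 / a)) (?h (n + 2) * ?h m) - smult (of_real (4 / a)) (?h n * ?h'' m)) x"
      "(mat_poly (Q n) x ** W x ** conj_transpose (mat_poly (Q m) x)) $ 2 $ 1 = gauss_fun
        (smult (of_real (16 / a)) (?h (m + 2) * ?h n) - smult (of_real (4 / a)) (?h m * ?h'' n)) x"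
      "(mat_poly (Q n) x ** W x ** conj_transpose (mat_poly (Q m) x)) $ 2 $ 2 = gauss_fun
        (?h'' n * ?h'' m + smult (of_real (16 / a\<^sup>2)) (?h n * ?h m)) x" for x
      unfolding factor snd_col1 snd_col2
      unfolding fst_col
      by (simp_all only: complex_cnj_mult complex_cnj_minus complex_cnj_numeral
          complex_cnj_complex_of_real cnj_poly_hermite cnj'')
        (simp_all add: gauss_fun_def power2_eq_square algebra_simps)
    have orth: "gauss_int (?h n * ?h m) = 0" "gauss_int (?h (n + 2) * ?h (m + 2)) = 0"
      using that by (simp_all add: gauss_int_hermite_orthogonal)
    have orth'': "gauss_int (?h'' n * ?h'' m) = 0"
    \<comment> \<open>Truncated subtraction could identify \<open>n - 1 - 1\<close> and
      \<open>m - 1 - 1\<close> for small indices, but there a second derivative is zero.\<close>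
    proof (cases "n < 2 \<or> m < 2")
      case True
      then have "?h'' n = 0 \<or> ?h'' m = 0"
        by (auto simp: less_2_cases_iff pderiv_hermite pderiv_smult)
      then show ?thesis by auto
    next
      case False
      with that have "n - 1 - 1 \<noteq> m - 1 - 1" by linarith
      then show ?thesis
        by (simp add: pderiv_hermite pderiv_smult gauss_int_hermite_orthogonal)
    qed
    \<comment> \<open>Two raising steps cost a factor 1/4, which turns \<open>16/a\<close> into
      \<open>4/a\<close> and makes both off-diagonal integrals cancel.\<close>
    have adjoint: "gauss_int (?h (k + 2) * q) = gauss_int (?h k * pderiv (pderiv q)) / 4" for k q
      by (simp add: gauss_int_hermite_Suc)
    have "mat_inner (-\<infinity>) \<infinity> W (Q n) (Q m) $ i $ j = 0" for i j
      unfolding mat_inner_def set_lebesgue_integral_def einterval_eq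
      using exhaust_2[of i] exhaust_2[of j]
      by (elim disjE; hypsubst)
        (simp_all add: integrands gauss_int_def[symmetric] orth orth''
          adjoint[of n "?h m"] adjoint[of m "?h n"]
          del: gauss_fun_linear add_2_eq_Suc')
    then show ?thesis
      by (simp add: vec_eq_iff)
  qed
  ultimately show ?thesis
    using gauss_weight_matrix[OF W] by (simp add: matrix_orthogonal_polynomials_def)
qed

end
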